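(* Let $n\ge 1$ and $k\ge 1$ be integers and let $\mathbb{P}$ be a $k$-homogeneous probability measure on $\mathcal{B}_n=\{0,1\}^n$ satisfying the stochastic covering property. Let $f:\mathcal{B}_n\to\mathbb{R}$ be a Lipschitz-1 function. Then for every real $a\ge 0$, $$\mathbb{P}(f-\mathbb{E}f\ge a)\le \exp\left(-\frac{a^2}{8k}\right).$$
   Context: $\mathcal{B}_n=\{0,1\}^n$ carries the coordinatewise partial order, and $X_1,\dots,X_n$ denote the coordinate functions. A probability measure on $\mathcal{B}_n$ is $k$-homogeneous if it is supported on $\{\omega:\sum_{j=1}^n\omega_j=k\}$. A function $f$ on $\mathcal{B}_n$ is Lipschitz-1 if $|f(x)-f(x')|\le 1$ whenever $x,x'$ differ in exactly one coordinate. For $x,y\in\{0,1\}^T$ ($T$ a finite set), $x$ covers $y$ if $x>y$ coordinatewise and there is no $z$ with $x>z>y$ (i.e. $x$ is obtained from $y$ by changing exactly one $0$ to $1$). A probability measure $\nu$ on $\{0,1\}^T$ stochastically covers a probability measure $\rho$ on $\{0,1\}^T$ if there is a coupling, i.e. a probability measure on $\{0,1\}^T\times\{0,1\}^T$ with first marginal $\nu$ and second marginal $\rho$, supported on pairs $(x,y)$ such that $x=y$ or $x$ covers $y$. Stochastic covering property (SCP): a probability measure $\nu$ on $\mathcal{B}_n$ has the SCP if for every $S\subseteq\{1,\dots,n\}$ and all $x,y\in\{0,1\}^S$ such that $x$ covers $y$ (and both conditioning events below have positive probability), the conditional law $(\nu\mid X_j=y_j,\ j\in S)$ stochastically covers the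 conditional law $(\nu\mid X_j=x_j,\ j\in S)$, both viewed as laws on the remaining coordinates $\{0,1\}^{S^c}$. *)

theory Defs
  imports "HOL-Probability.Probability"
begin

(* The cube {0,1}^T is the set of functions T -> {0,1} extended by undefined outside T,
   so the pointwise order on functions restricts to the coordinatewise order on the cube. *)

definition cube :: "'i set \<Rightarrow> ('i \<Rightarrow> nat) set" where
  "cube T = T \<rightarrow>\<^sub>E {0, 1}"

definition covers :: "'i set \<Rightarrow> ('i \<Rightarrow> nat) \<Rightarrow> ('i \<Rightarrow> nat) \<Rightarrow> bool" where
  "covers T x y \<longleftrightarrow> x \<in> cube T \<and> y \<in> cube T \<and> y < x \<and> \<not> (\<exists>z\<in>cube T. y < z \<and> z < x)"

definition stochastically_covers ::
    "'i set \<Rightarrow> ('i \<Rightarrow> nat) pmf \<Rightarrow> ('i \<Rightarrow> nat) pmf \<Rightarrow> bool" where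
  "stochastically_covers T \<nu> \<rho> \<longleftrightarrow>
     (\<exists>C. map_pmf fst C = \<nu> \<and> map_pmf snd C = \<rho> \<and>
          set_pmf C \<subseteq> {(x, y). x \<in> cube T \<and> y \<in> cube T \<and> (x = y \<or> covers T x y)})"

definition agree_on :: "'i set \<Rightarrow> ('i \<Rightarrow> nat) \<Rightarrow> ('i \<Rightarrow> nat) set" where
  "agree_on S y = {\<omega>. \<forall>j\<in>S. \<omega> j = y j}"

(* The law of the coordinates in I - S given X_j = y_j for j in S; only meaningful when
   the conditioning event has positive probability, as cond_pmf is unspecified otherwise. *)

definition cond_law ::
    "'i set \<Rightarrow> ('i \<Rightarrow> nat) pmf \<Rightarrow> 'i set \<Rightarrow> ('i \<Rightarrow> nat) \<Rightarrow> ('i \<Rightarrow> nat) pmf" where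
  "cond_law I \<nu> S y = map_pmf (\<lambda>\<omega>. restrict \<omega> (I - S)) (cond_pmf \<nu> (agree_on S y))"

definition stochastic_covering_property :: "'i set \<Rightarrow> ('i \<Rightarrow> nat) pmf \<Rightarrow> bool" where
  "stochastic_covering_property I \<nu> \<longleftrightarrow>
     (\<forall>S x y. S \<subseteq> I \<longrightarrow> covers S x y \<longrightarrow>
        measure_pmf.prob \<nu> (agree_on S x) > 0 \<longrightarrow>
        measure_pmf.prob \<nu> (agree_on S y) > 0 \<longrightarrow>
        stochastically_covers (I - S) (cond_law I \<nu> S y) (cond_law I \<nu> S x))"

definition homogeneous :: "'i set \<Rightarrow> nat \<Rightarrow> ('i \<Rightarrow> nat) pmf \<Rightarrow> bool" where
  "homogeneous I k \<nu> \<longleftrightarrow> set_pmf \<nu> \<subseteq> {\<omega> \<in> cube I. (\<Sum>j\<in>I. \<omega> j) = k}"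

definition lipschitz_1 :: "'i set \<Rightarrow> (('i \<Rightarrow> nat) \<Rightarrow> real) \<Rightarrow> bool" where
  "lipschitz_1 I f \<longleftrightarrow>
     (\<forall>x\<in>cube I. \<forall>x'\<in>cube I. (\<exists>!j. j \<in> I \<and> x j \<noteq> x' j) \<longrightarrow> \<bar>f x - f x'\<bar> \<le> 1)"

end

theory Submission imports Defs
begin

text \<open>
  Reveal the positions of the \<open>k\<close> ones in uniformly random order. By homogeneity, given that the
  positions in \<open>S\<close> have been revealed, the law of the configuration is \<open>P\<close> conditioned on
  \<open>X\<^sub>j = 1\<close> for \<open>j \<in> S\<close>, so revealing one more position \<open>i\<close> changes the conditional mean of \<open>f\<close>
  by at most its difference between the conditions \<open>X\<^sub>i = 1\<close> and \<open>X\<^sub>i = 0\<close>. The covering coupling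
  of these two laws gives configurations that differ at \<open>i\<close> and in at most one other coordinate,
  hence the martingale has increments at most \<open>2\<close> and Azuma's argument over \<open>k\<close> steps applies.
\<close>

section \<open>Hoeffding's lemma for finite weighted averages\<close>

text \<open>The weights form a pmf under which \<open>x\<close> is centred with values in an
  interval of length \<open>2 * c\<close>, so Hoeffding's exponent
  \<open>l^2 * (2 * c)^2 / 8\<close> becomes \<open>l^2 * c^2 / 2\<close>. The bound on
  \<open>x i\<close> is asked only where \<open>w i\<close> is positive: in the application the
  other indices stand for conditioning on null events, where \<open>x i\<close> is
  unspecified.\<close>

lemma hoeffding_weighted_sum:
  fixes w x :: "'i \<Rightarrow> real" and c l :: real
  assumes fin: "finite I" and w: "\<And>i. i \<in> I \<Longrightarrow> 0 \<le> w i" and w1: "(\<Sum>i\<in>I. w i) = 1"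
    and mean: "(\<Sum>i\<in>I. w i * x i) = 0"
    and bnd: "\<And>i. i \<in> I \<Longrightarrow> 0 < w i \<Longrightarrow> \<bar>x i\<bar> \<le> c"
    and l: "0 < l"
  shows "(\<Sum>i\<in>I. w i * exp (l * x i)) \<le> exp (l\<^sup>2 * c\<^sup>2 / 2)"
proof -
  \<comment> \<open>\<open>embed_pmf\<close> takes a function on the whole type, hence the extension
    of the weights by zero outside \<open>I\<close>.\<close>
  define v where "v i = (if i \<in> I then w i else 0)" for i
  define p where "p = embed_pmf v"
  have vnn: "0 \<le> v i" for i
    by (simp add: v_def w)
  have "(\<integral>\<^sup>+i. ennreal (v i) \<partial>count_space UNIV) = (\<Sum>i\<in>I. ennreal (v i))"
    by (intro nn_integral_count_space'[OF fin]) (auto simp: v_def)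
  also have "\<dots> = 1"
    using w w1 by (simp add: sum_ennreal v_def)
  finally have pmf_p: "pmf p i = v i" for i
    unfolding p_def by (intro pmf_embed_pmf vnn) auto
  have sub: "set_pmf p \<subseteq> I"
    by (auto simp: set_pmf_iff pmf_p v_def split: if_splits)
  have E: "measure_pmf.expectation p g = (\<Sum>i\<in>I. w i * g i)" for g :: "'i \<Rightarrow> real"
    using sub by (subst integral_measure_pmf_real[OF fin])
      (auto simp: pmf_p v_def mult.commute intro!: sum.cong)
  have "\<bar>x i\<bar> \<le> c" if "i \<in> set_pmf p" for i
  proof (rule bnd)
    show "i \<in> I"
      using that sub by auto
    show "0 < w i"
      using pmf_positive[OF that] \<open>i \<in> I\<close> by (simp add: pmf_p v_def)
  qed
  then interpret interval_bounded_random_variable "measure_pmf p" x "-c" c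
    by unfold_locales (auto simp: AE_measure_pmf_iff abs_le_iff minus_le_iff)
  have "ennreal (measure_pmf.expectation p (\<lambda>i. exp (l * x i))) =
      (\<integral>\<^sup>+i. ennreal (exp (l * x i)) \<partial>measure_pmf p)"
    using finite_subset[OF sub fin]
    by (intro nn_integral_eq_integral[symmetric] integrable_measure_pmf_finite) auto
  also have "\<dots> \<le> ennreal (exp (l\<^sup>2 * (c - -c)\<^sup>2 / 8))"
    using Hoeffdings_lemma_nn_integral_0[OF l] mean by (simp add: E)
  also have "l\<^sup>2 * (c - -c)\<^sup>2 / 8 = l\<^sup>2 * c\<^sup>2 / 2"
    by (simp add: power2_eq_square algebra_simps)
  finally show ?thesis
    by (simp add: E)
qed

section \<open>The cube and its covering relation\<close>

lemma mem_cube_iff: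
  "x \<in> cube T \<longleftrightarrow> (\<forall>i\<in>T. x i = 0 \<or> x i = 1) \<and> (\<forall>i. i \<notin> T \<longrightarrow> x i = undefined)"
  by (auto simp: cube_def PiE_def extensional_def Pi_def)

text \<open>If \<open>y < x\<close> differ at \<open>j\<close>, then \<open>y(j := 1)\<close> lies
  above \<open>y\<close> and below or at \<open>x\<close>, so a cover leaves no choice but
  \<open>x = y(j := 1)\<close>. Conversely, a point between \<open>y\<close> and
  \<open>y(j := 1)\<close> agrees with \<open>y\<close> off \<open>j\<close> and has only two
  possible values at \<open>j\<close>.\<close>

lemma covers_iff:
  "covers T x y \<longleftrightarrow> y \<in> cube T \<and> (\<exists>j\<in>T. y j = 0 \<and> x = y(j := 1))"
proof
  assume c: "covers T x y"
  then have x: "x \<in> cube T" and y: "y \<in> cube T" and "y < x"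
    and no: "\<And>z. z \<in> cube T \<Longrightarrow> y < z \<Longrightarrow> \<not> z < x"
    by (auto simp: covers_def)
  from \<open>y < x\<close> obtain j where j: "y j < x j" and le: "\<And>i. y i \<le> x i"
    by (auto simp: less_fun_def le_fun_def not_le)
  \<comment> \<open>Outside \<open>T\<close> both points are \<open>undefined\<close>, so they
    cannot differ there.\<close>
  have "j \<in> T"
    using j x y by (cases "j \<in> T") (auto simp: mem_cube_iff)
  then have "x j \<in> {0, 1}"
    using x by (auto simp: mem_cube_iff)
  then have yj: "y j = 0" and xj: "x j = 1"
    using j by auto
  let ?z = "y(j := 1)"
  have "?z \<in> cube T"
    using y \<open>j \<in> T\<close> by (auto simp: mem_cube_iff)
  moreover have "y < ?z"
    using yj by (auto simp: less_fun_def le_fun_def intro!: exI[of _ j])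
  ultimately have "\<not> ?z < x"
    by (rule no)
  moreover have "?z \<le> x"
    using le xj by (auto simp: le_fun_def)
  ultimately have "x = ?z"
    by (simp add: order.strict_iff_order)
  with y \<open>j \<in> T\<close> yj show "y \<in> cube T \<and> (\<exists>j\<in>T. y j = 0 \<and> x = y(j := 1))"
    by blast
next
  assume "y \<in> cube T \<and> (\<exists>j\<in>T. y j = 0 \<and> x = y(j := 1))"
  then obtain j where y: "y \<in> cube T" and j: "j \<in> T" "y j = 0" and x: "x = y(j := 1)"
    by blast
  have "x \<in> cube T"
    using y j by (auto simp: x mem_cube_iff)
  moreover have "y < x"
    using j by (auto simp: x less_fun_def le_fun_def intro!: exI[of _ j])
  moreover have "\<not> z < x" if z: "z \<in> cube T" "y < z" for z
  proof
    assume "z < x"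
    have le: "y i \<le> z i" "z i \<le> x i" for i
      using \<open>y < z\<close> \<open>z < x\<close> by (auto simp: less_fun_def le_fun_def)
    have eq: "z i = y i" if "i \<noteq> j" for i
      using le(1)[of i] le(2)[of i] that by (simp add: x)
    have "z j = y j \<or> z j = x j"
      using le(1)[of j] le(2)[of j] j by (auto simp: x)
    then have "z = y \<or> z = x"
      by (metis eq ext fun_upd_other x)
    with \<open>y < z\<close> \<open>z < x\<close> show False
      by auto
  qed
  ultimately show "covers T x y"
    using y by (auto simp: covers_def)
qed

lemma finite_cube: "finite I \<Longrightarrow> finite (cube I)"
  by (simp add: cube_def finite_PiE)

lemma merge_in_cube:
  assumes "x \<in> cube T" "u \<in> cube (I - T)" "T \<subseteq> I"
  shows "merge T (I - T) (x, u) \<in> cube I"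
  using assms by (auto simp: mem_cube_iff merge_def)

lemma lipschitz_1_covers:
  assumes "lipschitz_1 I f" "covers I x y"
  shows "\<bar>f x - f y\<bar> \<le> 1"
proof -
  obtain j where j: "j \<in> I" "y j = 0" "x = y(j := 1)" and "y \<in> cube I" "x \<in> cube I"
    using assms(2) covers_iff[of I x y] by (auto simp: covers_def)
  moreover have "\<exists>!j. j \<in> I \<and> x j \<noteq> y j"
    using j by (intro ex1I[of _ j]) (auto split: if_splits)
  ultimately show ?thesis
    using assms(1) by (auto simp: lipschitz_1_def)
qed

section \<open>Conditional means under the covering coupling\<close>

text \<open>Couplings live on the coordinates \<open>I - T\<close>, whereas \<open>f\<close> takes
  full configurations. Conditioning fixes the coordinates in \<open>T\<close>, so
  \<open>merge\<close> recovers the configuration from its restriction.\<close>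

lemma expectation_cond_pmf_agree_on:
  fixes f :: "('i \<Rightarrow> nat) \<Rightarrow> real"
  assumes "set_pmf P \<subseteq> cube I" "T \<subseteq> I" "set_pmf P \<inter> agree_on T x \<noteq> {}"
  shows "measure_pmf.expectation (cond_pmf P (agree_on T x)) f =
    measure_pmf.expectation (cond_law I P T x) (\<lambda>u. f (merge T (I - T) (x, u)))"
proof -
  have "merge T (I - T) (x, restrict \<omega> (I - T)) = \<omega>" if "\<omega> \<in> set_pmf P \<inter> agree_on T x" for \<omega>
  proof
    fix i
    show "merge T (I - T) (x, restrict \<omega> (I - T)) i = \<omega> i"
      using that assms(1,2)
      by (auto simp: merge_def agree_on_def mem_cube_iff)
  qed
  then show ?thesis
    unfolding cond_law_def integral_map_pmf
    using assms(3) by (intro integral_cong_AE) (auto simp: AE_measure_pmf_iff)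
qed

text \<open>For a coupled pair \<open>(u, v)\<close>, pass from \<open>merge (x, v)\<close> to
  \<open>merge (y, v)\<close> to \<open>merge (y, u)\<close>, leaving the index sets implicit. The
  first move flips the one coordinate of \<open>T\<close> where \<open>x\<close> and
  \<open>y\<close> differ, the second at most one coordinate of \<open>I - T\<close>; each costs at
  most 1.\<close>

lemma cond_expectation_diff_le:
  fixes f :: "('i \<Rightarrow> nat) \<Rightarrow> real"
  assumes fin: "finite I" and P: "set_pmf P \<subseteq> cube I" and scp: "stochastic_covering_property I P"
    and lip: "lipschitz_1 I f" and T: "T \<subseteq> I" and cov: "covers T x y"
    and x: "set_pmf P \<inter> agree_on T x \<noteq> {}" and y: "set_pmf P \<inter> agree_on T y \<noteq> {}"
  shows "\<bar>measure_pmf.expectation (cond_pmf P (agree_on T x)) f -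
          measure_pmf.expectation (cond_pmf P (agree_on T y)) f\<bar> \<le> 2"
proof -
  have "measure_pmf.prob P (agree_on T x) > 0" "measure_pmf.prob P (agree_on T y) > 0"
    using x y by (auto intro: measure_pmf_posI)
  then have "stochastically_covers (I - T) (cond_law I P T y) (cond_law I P T x)"
    using scp T cov by (auto simp: stochastic_covering_property_def)
  then obtain C where C: "map_pmf fst C = cond_law I P T y" "map_pmf snd C = cond_law I P T x"
    and sub: "set_pmf C \<subseteq> {(u, v). u \<in> cube (I - T) \<and> v \<in> cube (I - T) \<and> (u = v \<or> covers (I - T) u v)}"
    by (auto simp: stochastically_covers_def)
  have xc: "x \<in> cube T" and yc: "y \<in> cube T"
    using cov by (auto simp: covers_def)
  let ?m = "merge T (I - T)"
  \<comment> \<open>The smaller condition \<open>y\<close> has the larger conditional law, so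
    \<open>y\<close> goes with the first component of the coupling and \<open>x\<close> with the
    second.\<close>
  let ?g = "\<lambda>p. f (?m (x, snd p))" and ?h = "\<lambda>p. f (?m (y, fst p))"
  have "set_pmf C \<subseteq> cube (I - T) \<times> cube (I - T)"
    using sub by auto
  then have "finite (set_pmf C)"
    by (rule finite_subset) (simp add: finite_cube fin)
  then have int: "integrable (measure_pmf C) g" for g :: "_ \<Rightarrow> real"
    by (rule integrable_measure_pmf_finite)
  have bnd: "\<bar>?g p - ?h p\<bar> \<le> 2" if p_in: "p \<in> set_pmf C" for p
  proof -
    obtain u v where p: "p = (u, v)"
      by fastforce
    then have uv: "u \<in> cube (I - T)" "v \<in> cube (I - T)" "u = v \<or> covers (I - T) u v"
      using sub p_in by auto
    obtain j where j: "j \<in> T" "y j = 0" "x = y(j := 1)"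
      using cov covers_iff[of T x y] by blast
    have "?m (x, v) = (?m (y, v))(j := 1)"
      using j by (auto simp: merge_def fun_eq_iff)
    moreover have "?m (y, v) j = 0"
      using j by (simp add: merge_def)
    ultimately have "covers I (?m (x, v)) (?m (y, v))"
      unfolding covers_iff using merge_in_cube[OF yc uv(2) T] T j by blast
    then have 1: "\<bar>f (?m (x, v)) - f (?m (y, v))\<bar> \<le> 1"
      by (rule lipschitz_1_covers[OF lip])
    have 2: "\<bar>f (?m (y, u)) - f (?m (y, v))\<bar> \<le> 1"
      using uv(3)
    proof
      assume "covers (I - T) u v"
      then obtain i where i: "i \<in> I - T" "v i = 0" "u = v(i := 1)"
        unfolding covers_iff by blast
      have "?m (y, u) = (?m (y, v))(i := 1)"
        using i by (auto simp: merge_def fun_eq_iff)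
      moreover have "?m (y, v) i = 0"
        using i by (simp add: merge_def)
      ultimately have "covers I (?m (y, u)) (?m (y, v))"
        unfolding covers_iff using merge_in_cube[OF yc uv(2) T] i by blast
      then show ?thesis
        by (rule lipschitz_1_covers[OF lip])
    qed simp
    show ?thesis
      using 1 2 by (simp add: p)
  qed
  have "measure_pmf.expectation (cond_pmf P (agree_on T x)) f -
        measure_pmf.expectation (cond_pmf P (agree_on T y)) f =
      measure_pmf.expectation C ?g - measure_pmf.expectation C ?h"
    by (simp only: expectation_cond_pmf_agree_on[OF P T x] expectation_cond_pmf_agree_on[OF P T y]
        C[symmetric] integral_map_pmf)
  also have "\<dots> = measure_pmf.expectation C (\<lambda>p. ?g p - ?h p)"
    by (simp add: Bochner_Integration.integral_diff[OF int int])
  also have "\<bar>\<dots>\<bar> \<le> measure_pmf.expectation C (\<lambda>p. \<bar>?g p - ?h p\<bar>)"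
    by (rule integral_abs_bound)
  also have "\<dots> \<le> measure_pmf.expectation C (\<lambda>p. 2)"
    by (intro integral_mono_AE int) (auto simp: AE_measure_pmf_iff bnd)
  finally show ?thesis
    by simp
qed

section \<open>Revealing one more position\<close>

text \<open>Multiplying through by the probability of \<open>A\<close> makes the identity hold for
  null \<open>A\<close> too, where \<open>cond_pmf\<close> is unspecified; sums over events then
  need no positivity assumptions.\<close>

lemma sum_pmf_Int_eq_expectation_cond:
  fixes g :: "'a \<Rightarrow> real"
  assumes "finite (set_pmf P)"
  shows "(\<Sum>\<omega>\<in>set_pmf P \<inter> A. pmf P \<omega> * g \<omega>) =
    measure_pmf.prob P A * measure_pmf.expectation (cond_pmf P A) g"
proof (cases "set_pmf P \<inter> A = {}")
  case True
  then have "measure_pmf.prob P A = 0"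
    by (simp add: measure_pmf_zero_iff Int_commute)
  with True show ?thesis
    by simp
next
  case False
  have "measure_pmf.prob P A \<noteq> 0"
    using False by (simp add: measure_pmf_zero_iff Int_commute)
  moreover have "measure_pmf.expectation (cond_pmf P A) g =
      (\<Sum>\<omega>\<in>set_pmf P \<inter> A. g \<omega> * pmf (cond_pmf P A) \<omega>)"
    using assms False by (intro integral_measure_pmf_real) auto
  ultimately show ?thesis
    using False by (simp add: pmf_cond sum_distrib_left mult.commute)
qed

text \<open>In a uniformly random order, every configuration with \<open>k\<close> ones that include
  \<open>S\<close> is equally likely to show \<open>S\<close> first. The revealed set
  \<open>S\<close> therefore carries exactly the information that all its coordinates are 1.\<close>

abbreviation given_ones :: "('i \<Rightarrow> nat) pmf \<Rightarrow> 'i set \<Rightarrow> ('i \<Rightarrow> nat) pmf" where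
  "given_ones P S \<equiv> cond_pmf P (agree_on S (\<lambda>_. 1))"

abbreviation prob_ones :: "('i \<Rightarrow> nat) pmf \<Rightarrow> 'i set \<Rightarrow> real" where
  "prob_ones P S \<equiv> measure_pmf.prob P (agree_on S (\<lambda>_. 1))"

lemma card_remaining_ones:
  assumes fin: "finite I" and S: "S \<subseteq> I" and hom: "homogeneous I k P"
    and w: "\<omega> \<in> set_pmf P \<inter> agree_on S (\<lambda>_. 1)"
  shows "card {i \<in> I - S. \<omega> i = 1} + card S = k"
proof -
  have c: "\<omega> \<in> cube I" and k: "(\<Sum>j\<in>I. \<omega> j) = k" and S1: "\<And>j. j \<in> S \<Longrightarrow> \<omega> j = 1"
    using w hom by (auto simp: homogeneous_def agree_on_def)
  have "(\<Sum>j\<in>I. \<omega> j) = (\<Sum>j\<in>I - S. \<omega> j) + (\<Sum>j\<in>S. \<omega> j)"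
    by (rule sum.subset_diff[OF S fin])
  also have "(\<Sum>j\<in>S. \<omega> j) = card S"
    using S1 by simp
  also have "(\<Sum>j\<in>I - S. \<omega> j) = (\<Sum>j\<in>I - S. if \<omega> j = 1 then 1 else 0)"
    using c by (intro sum.cong) (auto simp: mem_cube_iff)
  also have "\<dots> = card {i \<in> I - S. \<omega> i = 1}"
    using fin by (simp add: sum.If_cases Int_def)
  finally show ?thesis
    using k by simp
qed

text \<open>Double counting of the pairs \<open>(\<omega>, i)\<close> with \<open>i\<close> outside
  \<open>S\<close> and \<open>\<omega> i = 1\<close>: by homogeneity each \<open>\<omega>\<close>
  with ones on \<open>S\<close> occurs \<open>k - card S\<close> times. After normalization this is
  the law of total expectation for one revealing step.\<close>

lemma sum_reveal_one:
  fixes g :: "('i \<Rightarrow> nat) \<Rightarrow> real"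
  assumes fin: "finite I" and S: "S \<subseteq> I" and hom: "homogeneous I k P"
    and finP: "finite (set_pmf P)"
  shows "real (k - card S) * (prob_ones P S * measure_pmf.expectation (given_ones P S) g) =
    (\<Sum>i\<in>I - S. prob_ones P (insert i S) * measure_pmf.expectation (given_ones P (insert i S)) g)"
proof -
  let ?A = "\<lambda>S. set_pmf P \<inter> agree_on S (\<lambda>_. 1)"
  have "(\<Sum>i\<in>I - S. \<Sum>\<omega>\<in>?A (insert i S). pmf P \<omega> * g \<omega>) =
      (\<Sum>i\<in>I - S. \<Sum>\<omega>\<in>?A S. if \<omega> i = 1 then pmf P \<omega> * g \<omega> else 0)"
  proof (rule sum.cong)
    fix i
    have "?A (insert i S) = {\<omega> \<in> ?A S. \<omega> i = 1}"
      by (auto simp: agree_on_def)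
    then show "(\<Sum>\<omega>\<in>?A (insert i S). pmf P \<omega> * g \<omega>) =
        (\<Sum>\<omega>\<in>?A S. if \<omega> i = 1 then pmf P \<omega> * g \<omega> else 0)"
      using finP by (simp only: sum.inter_filter finite_Int simp_thms)
  qed simp
  also have "\<dots> = (\<Sum>\<omega>\<in>?A S. \<Sum>i\<in>I - S. if \<omega> i = 1 then pmf P \<omega> * g \<omega> else 0)"
    by (rule sum.swap)
  also have "\<dots> = (\<Sum>\<omega>\<in>?A S. real (k - card S) * (pmf P \<omega> * g \<omega>))"
  proof (rule sum.cong)
    fix \<omega> assume "\<omega> \<in> ?A S"
    then have "card {i \<in> I - S. \<omega> i = 1} = k - card S"
      using card_remaining_ones[OF fin S hom] by fastforce
    then show "(\<Sum>i\<in>I - S. if \<omega> i = 1 then pmf P \<omega> * g \<omega> else 0) =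
        real (k - card S) * (pmf P \<omega> * g \<omega>)"
      using fin by (simp add: sum.If_cases Int_def)
  qed simp
  finally show ?thesis
    by (simp add: sum_pmf_Int_eq_expectation_cond[OF finP] sum_distrib_left[symmetric])
qed

text \<open>The law given ones on \<open>S\<close> is a mixture of the laws with
  \<open>X_i = 1\<close> and \<open>X_i = 0\<close> added. The distance from the mixture mean to the
  first mean is thus a fraction of the distance between the two means, which the coupling bounds by
  2.\<close>

lemma reveal_one_diff_le:
  fixes f :: "('i \<Rightarrow> nat) \<Rightarrow> real"
  assumes fin: "finite I" and P: "set_pmf P \<subseteq> cube I" and scp: "stochastic_covering_property I P"
    and lip: "lipschitz_1 I f" and S: "S \<subseteq> I" and i: "i \<in> I - S"
    and pos: "set_pmf P \<inter> agree_on (insert i S) (\<lambda>_. 1) \<noteq> {}"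
  shows "\<bar>measure_pmf.expectation (given_ones P (insert i S)) f -
          measure_pmf.expectation (given_ones P S) f\<bar> \<le> 2"
proof -
  let ?T = "insert i S"
  \<comment> \<open>The restriction puts \<open>x\<close> into \<open>cube ?T\<close>, as
    \<open>covers\<close> demands, without changing the event.\<close>
  define x where "x = restrict (\<lambda>_. 1::nat) ?T"
  define y where "y = x(i := 0)"
  let ?A = "agree_on S (\<lambda>_. 1::nat)"
  let ?Ax = "agree_on ?T x" and ?Ay = "agree_on ?T y"
  have Ax: "agree_on ?T (\<lambda>_. 1) = ?Ax"
    by (auto simp: agree_on_def x_def)
  have posS: "set_pmf P \<inter> ?A \<noteq> {}"
    using pos by (auto simp: agree_on_def)
  have finP: "finite (set_pmf P)"
    using P finite_cube[OF fin] by (rule finite_subset)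
  have split: "set_pmf P \<inter> ?A = (set_pmf P \<inter> ?Ax) \<union> (set_pmf P \<inter> ?Ay)"
  proof -
    have "\<omega> i = 0 \<or> \<omega> i = 1" if "\<omega> \<in> set_pmf P" for \<omega>
      using that P i mem_cube_iff[of \<omega> I] by auto
    then show ?thesis
      using i by (auto simp: agree_on_def x_def y_def) fastforce
  qed
  have disj: "(set_pmf P \<inter> ?Ax) \<inter> (set_pmf P \<inter> ?Ay) = {}"
    by (auto simp: agree_on_def x_def y_def)
  define E where "E A = measure_pmf.expectation (cond_pmf P A) f" for A
  define m where "m A = measure_pmf.prob P A" for A
  \<comment> \<open>Keeping \<open>g\<close> general serves twice: \<open>g = 1\<close> splits the
    mass, \<open>g = f\<close> the mean.\<close>
  have sum_split: "m ?A * measure_pmf.expectation (cond_pmf P ?A) g =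
      m ?Ax * measure_pmf.expectation (cond_pmf P ?Ax) g +
      m ?Ay * measure_pmf.expectation (cond_pmf P ?Ay) g" for g :: "_ \<Rightarrow> real"
    unfolding m_def sum_pmf_Int_eq_expectation_cond[OF finP, symmetric] split
    using finP disj by (intro sum.union_disjoint) auto
  have mS: "m ?A = m ?Ax + m ?Ay"
    using sum_split[of "\<lambda>_. 1"] by simp
  have mpos: "m ?A > 0"
    using posS by (auto simp: m_def intro: measure_pmf_posI)
  have EA: "m ?A * E ?A = m ?Ax * E ?Ax + m ?Ay * E ?Ay"
    unfolding E_def by (rule sum_split)
  have m_nonneg: "0 \<le> m A" for A
    by (simp add: m_def)
  have "m ?A * (E ?Ax - E ?A) = m ?Ay * (E ?Ax - E ?Ay)"
    unfolding right_diff_distrib EA unfolding mS by (simp add: algebra_simps)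
  then have "m ?A * \<bar>E ?Ax - E ?A\<bar> = m ?Ay * \<bar>E ?Ax - E ?Ay\<bar>"
    by (metis abs_mult abs_of_nonneg m_nonneg)
  also have "\<dots> \<le> m ?Ay * 2"
  \<comment> \<open>If \<open>?Ay\<close> is null, its conditional mean is unspecified but has
    factor 0.\<close>
  proof (cases "set_pmf P \<inter> ?Ay = {}")
    case True
    then have "m ?Ay = 0"
      by (simp add: m_def measure_pmf_zero_iff Int_commute)
    then show ?thesis
      by simp
  next
    case False
    have "covers ?T x y"
      unfolding covers_iff
      by (auto simp: x_def y_def mem_cube_iff fun_eq_iff intro!: bexI[of _ i])
    then have "\<bar>E ?Ax - E ?Ay\<bar> \<le> 2"
      unfolding E_def using False pos[unfolded Ax] i S
      by (intro cond_expectation_diff_le[OF fin P scp lip]) auto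
    then show ?thesis
      by (intro mult_left_mono m_nonneg)
  qed
  also have "\<dots> \<le> m ?A * 2"
    unfolding mS by (simp add: m_nonneg)
  finally have "\<bar>E ?Ax - E ?A\<bar> \<le> 2"
    using mpos by simp
  then show ?thesis
    unfolding E_def Ax .
qed

section \<open>The exponential moment by induction\<close>

text \<open>Induction on the number of ones still hidden. Revealing \<open>i\<close> splits the
  exponential into the factor of the increment \<open>x i\<close> and the one centred at the new
  mean. The induction hypothesis bounds the latter; averaging the former over \<open>i\<close> costs
  \<open>exp (2 * l^2)\<close> by Hoeffding with \<open>c = 2\<close>.\<close>

lemma mgf_given_ones_le:
  fixes f :: "('i \<Rightarrow> nat) \<Rightarrow> real"
  assumes fin: "finite I" and hom: "homogeneous I k P" and scp: "stochastic_covering_property I P"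
    and lip: "lipschitz_1 I f" and l: "0 < l"
    and S: "S \<subseteq> I" and pos: "set_pmf P \<inter> agree_on S (\<lambda>_. 1) \<noteq> {}"
  shows "measure_pmf.expectation (given_ones P S)
      (\<lambda>\<omega>. exp (l * (f \<omega> - measure_pmf.expectation (given_ones P S) f)))
    \<le> exp (2 * l\<^sup>2 * real (k - card S))"
  using S pos
proof (induction "k - card S" arbitrary: S)
  case 0
  let ?A = "set_pmf P \<inter> agree_on S (\<lambda>_. 1)"
  \<comment> \<open>With no ones left to reveal, the configuration is determined, so the conditional
    law is a point mass and the exponential moment is 1.\<close>
  have const: "\<omega> = \<omega>'" if "\<omega> \<in> ?A" "\<omega>' \<in> ?A" for \<omega> \<omega>'
  proof
    fix i
    have vals: "\<eta> i = (if i \<in> S then 1 else if i \<in> I then 0 else undefined)" if "\<eta> \<in> ?A" for \<eta>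
    proof -
      have "card {i \<in> I - S. \<eta> i = 1} + card S = k"
        by (rule card_remaining_ones[OF fin \<open>S \<subseteq> I\<close> hom that])
      then have "card {i \<in> I - S. \<eta> i = 1} = 0"
        using 0 by simp
      then have "{i \<in> I - S. \<eta> i = 1} = {}"
        using fin by simp
      moreover have "\<eta> \<in> cube I"
        using that hom by (auto simp: homogeneous_def)
      ultimately show ?thesis
        using that by (auto simp: agree_on_def mem_cube_iff)
    qed
    show "\<omega> i = \<omega>' i"
      by (simp only: vals that)
  qed
  obtain \<omega> where "?A = {\<omega>}"
    using const 0 by blast
  then have "given_ones P S = return_pmf \<omega>"
    using 0 by (simp flip: set_pmf_subset_singleton)
  then show ?case
    by simp
next
  case (Suc d)
  define E where "E S g = measure_pmf.expectation (given_ones P S) g" for S and g :: "_ \<Rightarrow> real"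
  have P: "set_pmf P \<subseteq> cube I"
    using hom by (auto simp: homogeneous_def)
  have finP: "finite (set_pmf P)"
    using P finite_cube[OF fin] by (rule finite_subset)
  \<comment> \<open>\<open>w i\<close> is the probability that \<open>i\<close> is revealed next: a
    uniform choice among the \<open>k - card S\<close> hidden ones.\<close>
  define N where "N = real (k - card S) * prob_ones P S"
  define w where "w i = prob_ones P (insert i S) / N" for i
  have "prob_ones P S > 0"
    using Suc.prems by (auto intro: measure_pmf_posI)
  then have N: "N > 0"
    using Suc.hyps(2) by (simp add: N_def flip: Suc.hyps(2))
  \<comment> \<open>Used for three functions: \<open>g = 1\<close> shows that the weights sum to 1,
    \<open>g = f\<close> that the increments are centred, and the exponential gives the
    recursion.\<close>
  have tower: "E S g = (\<Sum>i\<in>I - S. w i * E (insert i S) g)" for g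
  proof -
    have "N * E S g = (\<Sum>i\<in>I - S. prob_ones P (insert i S) * E (insert i S) g)"
      unfolding E_def N_def mult.assoc by (rule sum_reveal_one[OF fin \<open>S \<subseteq> I\<close> hom finP])
    then have "E S g = (\<Sum>i\<in>I - S. prob_ones P (insert i S) * E (insert i S) g) / N"
      using N by (simp add: eq_divide_eq mult.commute)
    then show ?thesis
      by (simp add: w_def sum_divide_distrib)
  qed
  have w_nonneg: "0 \<le> w i" for i
    using N by (simp add: w_def)
  have w1: "(\<Sum>i\<in>I - S. w i) = 1"
    using tower[of "\<lambda>_. 1"] by (simp add: E_def)
  have ne: "set_pmf P \<inter> agree_on (insert i S) (\<lambda>_. 1) \<noteq> {}" if "0 < w i" for i
  proof
    assume "set_pmf P \<inter> agree_on (insert i S) (\<lambda>_. 1) = {}"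
    then have "prob_ones P (insert i S) = 0"
      by (simp add: measure_pmf_zero_iff Int_commute)
    with that show False
      by (simp add: w_def)
  qed
  define x where "x i = E (insert i S) f - E S f" for i
  have "(\<Sum>i\<in>I - S. w i * x i) = 0"
    by (simp add: x_def right_diff_distrib sum_subtractf tower[symmetric] w1
        flip: sum_distrib_right)
  moreover have "\<bar>x i\<bar> \<le> 2" if "i \<in> I - S" "0 < w i" for i
    unfolding x_def E_def
    using reveal_one_diff_le[OF fin P scp lip \<open>S \<subseteq> I\<close> that(1) ne[OF that(2)]] .
  ultimately have hoeff: "(\<Sum>i\<in>I - S. w i * exp (l * x i)) \<le> exp (l\<^sup>2 * 2\<^sup>2 / 2)"
    using fin w_nonneg w1 l by (intro hoeffding_weighted_sum) auto
  have "E S (\<lambda>\<omega>. exp (l * (f \<omega> - E S f))) =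
      (\<Sum>i\<in>I - S. w i * E (insert i S) (\<lambda>\<omega>. exp (l * (f \<omega> - E S f))))"
    by (rule tower)
  also have "\<dots> \<le> (\<Sum>i\<in>I - S. w i * (exp (l * x i) * exp (2 * l\<^sup>2 * real d)))"
  proof (rule sum_mono)
    fix i assume i: "i \<in> I - S"
    show "w i * E (insert i S) (\<lambda>\<omega>. exp (l * (f \<omega> - E S f))) \<le>
        w i * (exp (l * x i) * exp (2 * l\<^sup>2 * real d))"
    \<comment> \<open>The induction hypothesis is available only for a non-null new condition;
      otherwise both sides vanish.\<close>
    proof (cases "0 < w i")
      case True
      have "card (insert i S) = Suc (card S)"
        using i \<open>S \<subseteq> I\<close> fin by (simp add: finite_subset)
      then have d: "d = k - card (insert i S)"
        using Suc.hyps(2) by simp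
      have "E (insert i S) (\<lambda>\<omega>. exp (l * (f \<omega> - E (insert i S) f))) \<le> exp (2 * l\<^sup>2 * real d)"
        unfolding E_def using Suc.hyps(1)[OF d _ ne[OF True]] i \<open>S \<subseteq> I\<close>
        by (simp add: d)
      then have "exp (l * x i) * E (insert i S) (\<lambda>\<omega>. exp (l * (f \<omega> - E (insert i S) f))) \<le>
          exp (l * x i) * exp (2 * l\<^sup>2 * real d)"
        by simp
      also have "exp (l * x i) * E (insert i S) (\<lambda>\<omega>. exp (l * (f \<omega> - E (insert i S) f))) =
          E (insert i S) (\<lambda>\<omega>. exp (l * x i) * exp (l * (f \<omega> - E (insert i S) f)))"
        by (simp add: E_def)
      also have "\<dots> = E (insert i S) (\<lambda>\<omega>. exp (l * (f \<omega> - E S f)))"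
        by (simp add: x_def algebra_simps flip: exp_add)
      finally show ?thesis
        by (intro mult_left_mono w_nonneg)
    qed (use w_nonneg[of i] in simp)
  qed
  also have "\<dots> = (\<Sum>i\<in>I - S. w i * exp (l * x i)) * exp (2 * l\<^sup>2 * real d)"
    by (simp add: sum_distrib_right mult.assoc)
  also have "\<dots> \<le> exp (l\<^sup>2 * 2\<^sup>2 / 2) * exp (2 * l\<^sup>2 * real d)"
    using hoeff by (intro mult_right_mono) auto
  also have "\<dots> = exp (2 * l\<^sup>2 * real (k - card S))"
    by (simp add: algebra_simps flip: exp_add Suc.hyps(2))
  finally show ?case
    by (simp add: E_def)
qed

section \<open>The Chernoff bound\<close>

theorem theorem3p1:
  fixes n k :: nat
    and P :: "(nat \<Rightarrow> nat) pmf"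
    and f :: "(nat \<Rightarrow> nat) \<Rightarrow> real"
    and a :: real
  assumes "1 \<le> n" and "1 \<le> k"
    and "set_pmf P \<subseteq> cube {1..n}"
    and "homogeneous {1..n} k P"
    and "stochastic_covering_property {1..n} P"
    and "lipschitz_1 {1..n} f"
    and "0 \<le> a"
  shows "measure_pmf.prob P {\<omega>. f \<omega> - measure_pmf.expectation P f \<ge> a}
           \<le> exp (- (a\<^sup>2 / (8 * real k)))"
proof (cases "a = 0")
  case False
  \<comment> \<open>This \<open>l\<close> minimizes \<open>2 * l^2 * k - l * a\<close>, with minimum
    \<open>- a^2 / (8 * k)\<close>. It is positive only for \<open>a > 0\<close>; at
    \<open>a = 0\<close> the claimed bound is 1.\<close>
  define l where "l = a / (4 * real k)"
  have l: "0 < l"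
    using False assms by (simp add: l_def)
  let ?X = "\<lambda>\<omega>. exp (l * (f \<omega> - measure_pmf.expectation P f))"
  have "finite (set_pmf P)"
    using assms(3) finite_cube by (rule finite_subset) simp
  then have int: "integrable (measure_pmf P) ?X"
    by (rule integrable_measure_pmf_finite)
  \<comment> \<open>The process starts with nothing revealed: \<open>S = {}\<close> conditions on
    the sure event and leaves all \<open>k\<close> ones hidden.\<close>
  have "agree_on {} (\<lambda>_. 1 :: nat) = (UNIV :: (nat \<Rightarrow> nat) set)"
    by (simp add: agree_on_def)
  moreover have "cond_pmf P UNIV = P"
    by (rule pmf_eqI) (simp add: pmf_cond set_pmf_not_empty)
  ultimately have mgf: "measure_pmf.expectation P ?X \<le> exp (2 * l\<^sup>2 * real k)"
    using mgf_given_ones_le[OF _ assms(4-6) l, of "{}"] by (simp add: set_pmf_not_empty)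
  have "{\<omega>. f \<omega> - measure_pmf.expectation P f \<ge> a} = {\<omega> \<in> space (measure_pmf P). ?X \<omega> \<ge> exp (l * a)}"
    using l by simp
  then have "measure_pmf.prob P {\<omega>. f \<omega> - measure_pmf.expectation P f \<ge> a} \<le>
      measure_pmf.expectation P ?X / exp (l * a)"
    using integral_Markov_inequality_measure[OF int, of UNIV "exp (l * a)"] by simp
  also have "\<dots> \<le> exp (2 * l\<^sup>2 * real k) / exp (l * a)"
    using mgf by (intro divide_right_mono) auto
  also have "\<dots> = exp (2 * l\<^sup>2 * real k - l * a)"
    by (simp add: exp_diff)
  also have "2 * l\<^sup>2 * real k - l * a = - (a\<^sup>2 / (8 * real k))"
    using assms(2) by (simp add: l_def field_simps power2_eq_square)
  finally show ?thesis .
qed simp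

end
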